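(* Let $\mathcal{S}^*$ be a family of switching signals which has property P, and let $\mathcal{T}^*$ be the set of all complete trajectories $(\bar x,\bar\sigma)$ of $\dot x=f(x,\sigma)$ with $\bar\sigma\in\mathcal{S}^*$. Let $(x,\sigma)$, with $\sigma\in\mathcal{S}^*$, be a forward complete trajectory of $\dot x=f(x,\sigma)$. Suppose in addition that there exists a continuous function $h:\mathrm{dom}(h)\to\mathbb{R}$, with $\mathrm{dom}(h)\subset\mathbb{R}^n\times\Gamma$, such that $(x(t),\sigma(t))$ evolves in a compact subset $K$ of $\mathrm{dom}(h)$ for all $t\ge0$ and such that $y(\cdot)=h(x(\cdot),\sigma(\cdot))$ is weakly meagre. Then $x\to\pi_1(M^* )$, where $M^*$ is the maximal weakly-invariant set with respect to $\mathcal{T}^*$ contained in $h^{-1}(0)\cap\mathrm{dom}(f)$.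
   Context: Setting: $\Gamma$ is a compact metric space, $\mathrm{dom}(f)\subset\mathbb{R}^n\times\Gamma$ is closed and $f:\mathrm{dom}(f)\to\mathbb{R}^n$ is continuous. A switching signal is a function $\sigma:\mathbb{R}\to\Gamma$ that is piecewise constant (at most finitely many jumps in each compact interval) and continuous from the right; $\Lambda(\sigma)$ is the set of times at which $\sigma$ has a jump. A solution of $\dot x=f(x,\sigma)$ corresponding to $\sigma$ is a locally absolutely continuous $x:I_x\to\mathbb{R}^n$, $I_x\subset\mathbb{R}$ a nonempty interval, with $(x(t),\sigma(t))\in\mathrm{dom}(f)$ for all $t\in I_x$ and $\dot x(t)=f(x(t),\sigma(t))$ for almost all $t\in I_x$. Then $(x,\sigma)$ is called a trajectory; it is complete if $I_x=\mathbb{R}$ and forward complete if $\mathbb{R}_{\ge0}\subset I_x$. For $\tau_D>0$ and $N_0\in\mathbb{N}$, $\mathcal{S}_a[\tau_D,N_0]$ is the set of switching signals $\sigma$ with $\mathrm{card}(\Lambda(\sigma)\cap(\tau_1,\tau_2))\le N_0+(\tau_2-\tau_1)/\tau_D$ for every finite open interval $(\tau_1,\tau_2)$. A family $\mathcal{S}^*$ of switching signals has property P if: (1) $\mathcal{S}^*\subset\mathcal{S}_a[\tau_D,N_0]$ for some $\tau_D>0$, $N_0\in\mathbb{N}$; (2) for any $s>0$ and any $\sigma\in\mathcal{S}^*$, $\sigma(\cdot+s)\in\mathcal{S}^*$; (3) for every sequence $\{\sigma_k\}\subset\mathcal{S}^*$ there exist $\sigma^*\in\mathcal{S}^*$ and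 a subsequence $\{\sigma_{k_l}\}$ with $\lim_{l\to\infty}\sigma_{k_l}(t)=\sigma^*(t)$ for almost all $t\in\mathbb{R}$. Weak invariance: given a family $\mathcal{T}^*$ of complete trajectories, a nonempty set $M\subset\mathbb{R}^n\times\Gamma$ is weakly-invariant with respect to $\mathcal{T}^*$ if for each $(\xi,\gamma)\in M$ there is $(x,\sigma)\in\mathcal{T}^*$ with $x(0)=\xi$, $\sigma(0)=\gamma$ and $(x(t),\sigma(t))\in M$ for all $t\in\mathbb{R}$. "Maximal" is with respect to inclusion. $\pi_1:\mathbb{R}^n\times\Gamma\to\mathbb{R}^n$ is the projection onto the first component. For $M\subset\mathbb{R}^n$, $x\to M$ means $\lim_{t\to+\infty}d(x(t),M)=0$, where $d(\xi,M)=\inf_{\nu\in M}|\nu-\xi|$. A function $y:\mathbb{R}_{\ge0}\to\mathbb{R}$ is weakly meagre if $\lim_{k\to\infty}(\inf\{|y(t)|:t\in I_k\})=0$ for every family $\{I_k:k\in\mathbb{N}\}$ of nonempty and pairwise disjoint intervals in $\mathbb{R}_{\ge0}$ with $\inf\{\mu(I_k):k\in\mathbb{N}\}>0$, where $\mu$ is Lebesgue measure. *)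

theory Defs
  imports "HOL-Analysis.Analysis"
begin

definition jump_times :: "(real \<Rightarrow> 'g::metric_space) \<Rightarrow> real set"
  where "jump_times \<sigma> = {t. \<not> isCont \<sigma> t}"

text \<open>The last conjunct is what makes \<open>\<sigma>\<close> piecewise constant and not merely piecewise continuous.\<close>

definition switching_signal :: "'g::metric_space set \<Rightarrow> (real \<Rightarrow> 'g) \<Rightarrow> bool"
  where "switching_signal \<Gamma> \<sigma> \<longleftrightarrow>
    (\<forall>t. \<sigma> t \<in> \<Gamma>) \<and>
    (\<forall>t. continuous (at_right t) \<sigma>) \<and>
    (\<forall>a b. finite (jump_times \<sigma> \<inter> {a..b})) \<and>
    (\<forall>J. is_interval J \<and> J \<inter> jump_times \<sigma> = {} \<longrightarrow> \<sigma> constant_on J)"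

definition absolutely_continuous_on_interval ::
    "real \<Rightarrow> real \<Rightarrow> (real \<Rightarrow> 'a::real_normed_vector) \<Rightarrow> bool"
  where "absolutely_continuous_on_interval a b x \<longleftrightarrow>
    (\<forall>\<epsilon>>0. \<exists>\<delta>>0. \<forall>(n::nat) u v.
      (\<forall>i<n. a \<le> u i \<and> u i \<le> v i \<and> v i \<le> b) \<and>
      disjoint_family_on (\<lambda>i. {u i<..<v i}) {..<n} \<and>
      (\<Sum>i<n. v i - u i) < \<delta>
      \<longrightarrow> (\<Sum>i<n. norm (x (v i) - x (u i))) < \<epsilon>)"

definition locally_absolutely_continuous_on ::
    "real set \<Rightarrow> (real \<Rightarrow> 'a::real_normed_vector) \<Rightarrow> bool"
  where "locally_absolutely_continuous_on I x \<longleftrightarrow>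
    (\<forall>a b. a \<le> b \<and> {a..b} \<subseteq> I \<longrightarrow> absolutely_continuous_on_interval a b x)"

text \<open>A partial function is a total one together with its domain: \<open>D\<close> is the domain of \<open>f\<close>,
  \<open>I\<close> that of \<open>x\<close>; values outside are irrelevant.\<close>

definition trajectory ::
    "'g::metric_space set \<Rightarrow> ((real^'n) \<times> 'g) set \<Rightarrow> ((real^'n) \<times> 'g \<Rightarrow> real^'n) \<Rightarrow>
     real set \<Rightarrow> (real \<Rightarrow> real^'n) \<Rightarrow> (real \<Rightarrow> 'g) \<Rightarrow> bool"
  where "trajectory \<Gamma> D f I x \<sigma> \<longleftrightarrow>
    switching_signal \<Gamma> \<sigma> \<and>
    is_interval I \<and> I \<noteq> {} \<and>
    locally_absolutely_continuous_on I x \<and>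
    (\<forall>t\<in>I. (x t, \<sigma> t) \<in> D) \<and>
    (AE t in lborel. t \<in> I \<longrightarrow> (x has_vector_derivative f (x t, \<sigma> t)) (at t within I))"

definition complete_trajectories ::
    "'g::metric_space set \<Rightarrow> ((real^'n) \<times> 'g) set \<Rightarrow> ((real^'n) \<times> 'g \<Rightarrow> real^'n) \<Rightarrow>
     (real \<Rightarrow> 'g) set \<Rightarrow> ((real \<Rightarrow> real^'n) \<times> (real \<Rightarrow> 'g)) set"
  where "complete_trajectories \<Gamma> D f S = {(x, \<sigma>). \<sigma> \<in> S \<and> trajectory \<Gamma> D f UNIV x \<sigma>}"

definition average_dwell_signals ::
    "'g::metric_space set \<Rightarrow> real \<Rightarrow> nat \<Rightarrow> (real \<Rightarrow> 'g) set"
  where "average_dwell_signals \<Gamma> \<tau>\<^sub>D N\<^sub>0 =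
    {\<sigma>. switching_signal \<Gamma> \<sigma> \<and>
        (\<forall>\<tau>\<^sub>1 \<tau>\<^sub>2. \<tau>\<^sub>1 < \<tau>\<^sub>2 \<longrightarrow>
          real (card (jump_times \<sigma> \<inter> {\<tau>\<^sub>1<..<\<tau>\<^sub>2})) \<le> real N\<^sub>0 + (\<tau>\<^sub>2 - \<tau>\<^sub>1) / \<tau>\<^sub>D)}"

definition property_P :: "'g::metric_space set \<Rightarrow> (real \<Rightarrow> 'g) set \<Rightarrow> bool"
  where "property_P \<Gamma> S \<longleftrightarrow>
    (\<exists>\<tau>\<^sub>D>0. \<exists>N\<^sub>0. S \<subseteq> average_dwell_signals \<Gamma> \<tau>\<^sub>D N\<^sub>0) \<and>
    (\<forall>s>0. \<forall>\<sigma>\<in>S. (\<lambda>t. \<sigma> (t + s)) \<in> S) \<and>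
    (\<forall>\<sigma>s :: nat \<Rightarrow> real \<Rightarrow> 'g. (\<forall>k. \<sigma>s k \<in> S) \<longrightarrow>
      (\<exists>\<sigma>'\<in>S. \<exists>r :: nat \<Rightarrow> nat. strict_mono r \<and>
        (AE t in lborel. (\<lambda>l. \<sigma>s (r l) t) \<longlonglongrightarrow> \<sigma>' t)))"

definition weakly_invariant ::
    "((real \<Rightarrow> real^'n) \<times> (real \<Rightarrow> 'g)) set \<Rightarrow> ((real^'n) \<times> 'g) set \<Rightarrow> bool"
  where "weakly_invariant T M \<longleftrightarrow>
    M \<noteq> {} \<and>
    (\<forall>(\<xi>, \<gamma>)\<in>M. \<exists>(x, \<sigma>)\<in>T. x 0 = \<xi> \<and> \<sigma> 0 = \<gamma> \<and> (\<forall>t. (x t, \<sigma> t) \<in> M))"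

definition maximal_weakly_invariant_in ::
    "((real \<Rightarrow> real^'n) \<times> (real \<Rightarrow> 'g)) set \<Rightarrow> ((real^'n) \<times> 'g) set \<Rightarrow>
     ((real^'n) \<times> 'g) set \<Rightarrow> bool"
  where "maximal_weakly_invariant_in T A M \<longleftrightarrow>
    weakly_invariant T M \<and> M \<subseteq> A \<and>
    (\<forall>N. weakly_invariant T N \<and> N \<subseteq> A \<and> M \<subseteq> N \<longrightarrow> N = M)"

text \<open>\<open>infdist\<close> to the empty set is 0 by convention, so this is meaningful only for nonempty \<open>M\<close>.\<close>

definition tends_to_set :: "(real \<Rightarrow> 'a::metric_space) \<Rightarrow> 'a set \<Rightarrow> bool"
  where "tends_to_set x M \<longleftrightarrow> ((\<lambda>t. infdist (x t) M) \<longlongrightarrow> 0) at_top"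

text \<open>Only the values of \<open>y\<close> on \<open>[0, \<infinity>)\<close> matter. The measure of an interval may be infinite,
  so the infimum of the measures is taken in \<^typ>\<open>ennreal\<close>.\<close>

definition weakly_meagre :: "(real \<Rightarrow> real) \<Rightarrow> bool"
  where "weakly_meagre y \<longleftrightarrow>
    (\<forall>J :: nat \<Rightarrow> real set.
      (\<forall>k. is_interval (J k) \<and> J k \<noteq> {} \<and> J k \<subseteq> {0..}) \<and>
      disjoint_family J \<and>
      (INF k. emeasure lborel (J k)) > 0
      \<longrightarrow> (\<lambda>k. INF t\<in>J k. \<bar>y t\<bar>) \<longlonglongrightarrow> 0)"

end

theory Submission
  imports Defs "HOL-Complex_Analysis.Great_Picard"
begin

text \<open>Along times \<open>\<tau>\<^sub>k \<rightarrow> \<infinity>\<close> the translates \<open>x(\<cdot> + \<tau>\<^sub>k)\<close> are equi-Lipschitz, because \<open>f\<close> is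
  bounded on \<open>K \<inter> dom(f)\<close>, so together with property P a subsequence converges pointwise to a
  pair \<open>(z, \<rho>)\<close>, which is a complete trajectory by dominated convergence in the integral form
  of the differential equation. The values \<open>(z(0), \<rho>(0))\<close> of these limits form a weakly
  invariant set, and \<open>x\<close> tends to its projection by construction. It lies in the zero set of \<open>h\<close>: if
  \<open>h(z(0), \<rho>(0)) \<noteq> 0\<close>, take a short interval to the right of 0 and cut it into more cells than a
  signal in \<open>S\<close> can have jumps. For large \<open>k\<close> some cell is free of jumps of \<open>\<sigma>(\<cdot> + \<tau>\<^sub>k)\<close>, and
  there \<open>\<bar>y\<bar>\<close> is bounded away from 0. As the cells have a fixed length, this contradicts weak
  meagreness.\<close>

section \<open>Absolutely continuous functions\<close>

text \<open>Expanding at \<open>t\<close> towards both ends, the errors \<open>e * (t - u)\<close>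
  and \<open>e * (v - t)\<close> add up to \<open>e * (v - u)\<close>. In this form
  differentiability enters a Henstock sum, where the tag lies anywhere in its cell.\<close>

lemma has_vector_derivative_straddle:
  fixes x :: "real \<Rightarrow> 'a::real_normed_vector"
  assumes "(x has_vector_derivative y) (at t within {a..b})" "e > 0"
  obtains d where "d > 0"
    "\<And>u v. \<lbrakk>u \<le> t; t \<le> v; {u..v} \<subseteq> {a..b}; {u..v} \<subseteq> ball t d\<rbrakk>
       \<Longrightarrow> norm ((v - u) *\<^sub>R y - (x v - x u)) \<le> e * (v - u)"
proof -
  from assms obtain d where d: "d > 0"
    "\<And>s. \<lbrakk>s \<in> {a..b}; norm (s - t) < d\<rbrakk> \<Longrightarrow> norm (x s - x t - (s - t) *\<^sub>R y) \<le> e * norm (s - t)"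
    unfolding has_vector_derivative_def has_derivative_within_alt by blast
  show thesis
  proof (rule that[OF d(1)])
    fix u v :: real
    assume uv: "u \<le> t" "t \<le> v" "{u..v} \<subseteq> {a..b}" "{u..v} \<subseteq> ball t d"
    then have mem: "u \<in> {u..v}" "v \<in> {u..v}" by auto
    with uv have "u \<in> {a..b}" "v \<in> {a..b}" "norm (u - t) < d" "norm (v - t) < d"
      by (auto simp: dist_norm norm_minus_commute subset_iff simp del: atLeastAtMost_iff real_norm_def)
    then have *: "norm (x u - x t - (u - t) *\<^sub>R y) \<le> e * (t - u)"
      "norm (x v - x t - (v - t) *\<^sub>R y) \<le> e * (v - t)"
      using d(2)[of u] d(2)[of v] uv by auto
    have "(v - u) *\<^sub>R y - (x v - x u) =
        (x u - x t - (u - t) *\<^sub>R y) - (x v - x t - (v - t) *\<^sub>R y)"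
      by (simp add: algebra_simps)
    also have "norm \<dots> \<le> e * (t - u) + e * (v - t)"
      using norm_triangle_ineq4 * by (meson add_mono order_trans)
    finally show "norm ((v - u) *\<^sub>R y - (x v - x u)) \<le> e * (v - u)"
      by (simp add: algebra_simps)
  qed
qed

text \<open>By outer regularity the null set \<open>N\<close> has an open neighbourhood of measure
  below the delta of absolute continuity, and non-overlapping cells inside it have total length
  below that delta.\<close>

lemma absolutely_continuous_small_variation:
  assumes ac: "absolutely_continuous_on_interval a b x" and N: "negligible N" and "e > 0"
  shows "\<exists>U. open U \<and> N \<subseteq> U \<and>
    (\<forall>q p. q \<subseteq> p \<and> p tagged_division_of {a..b} \<and> (\<forall>(t,k)\<in>q. k \<subseteq> U)
       \<longrightarrow> (\<Sum>(t,k)\<in>q. norm (x (Sup k) - x (Inf k))) < e)"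
proof -
  from ac \<open>e > 0\<close> obtain d where "d > 0" and d: "\<And>(n::nat) u v.
      \<lbrakk>\<And>i. i < n \<Longrightarrow> a \<le> u i \<and> u i \<le> v i \<and> v i \<le> b; disjoint_family_on (\<lambda>i. {u i<..<v i}) {..<n};
      (\<Sum>i<n. v i - u i) < d\<rbrakk> \<Longrightarrow> (\<Sum>i<n. norm (x (v i) - x (u i))) < e"
    unfolding absolutely_continuous_on_interval_def by (meson lessThan_iff)
  obtain U where U: "open U" "N \<subseteq> U" "U - N \<in> lmeasurable" "emeasure lebesgue (U - N) < ennreal d"
    using sets_lebesgue_outer_open[OF negligible_imp_sets[OF N] \<open>d > 0\<close>] by blast
  \<comment> \<open>Outer regularity bounds the measure of \<open>U - N\<close>; since
    \<open>N\<close> is null, the bound carries over to \<open>U\<close>.\<close>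
  have "emeasure lebesgue U \<le> emeasure lebesgue (U - N) + emeasure lebesgue N"
    using emeasure_subadditive[of "U - N" lebesgue N] U N
    by (simp add: negligible_imp_sets fmeasurableD Un_absorb2)
  also have "emeasure lebesgue N = 0"
    using N negligible_iff_null_sets by blast
  finally have emU: "emeasure lborel U < ennreal d"
    using U by (simp add: order_le_less_trans)
  show ?thesis
  proof (intro exI[of _ U] conjI U allI impI, elim conjE)
    fix q p
    assume qp: "q \<subseteq> p" and p: "p tagged_division_of {a..b}"
      and qU: "\<forall>(t,k)\<in>q. k \<subseteq> U"
    have "finite q"
      using p qp finite_subset by blast
    then obtain e' where e': "bij_betw e' {..<card q} q"
      by (metis atLeast0LessThan ex_bij_betw_nat_finite)
    define n where "n = card q"
    define u v where "u = (\<lambda>i. Inf (snd (e' i)))" and "v = (\<lambda>i. Sup (snd (e' i)))"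
    have mem: "e' i \<in> q" if "i < n" for i
      using e' that unfolding n_def bij_betw_def by auto
    have k: "snd (e' i) = {u i..v i} \<and> a \<le> u i \<and> u i \<le> v i \<and> v i \<le> b" if "i < n" for i
    proof -
      have ip: "(fst (e' i), snd (e' i)) \<in> p"
        using mem[OF that] qp by auto
      obtain c c' where "snd (e' i) = {c..c'}"
        using tagged_division_ofD(4)[OF p ip] by auto
      with ip p show ?thesis
        unfolding u_def v_def
        using tagged_division_ofD(2)[OF p ip] tagged_division_ofD(3)[OF p ip]
        by (simp add: cInf_atLeastAtMost)
    qed
    have disj: "disjoint_family_on (\<lambda>i. {u i<..<v i}) {..<n}"
      unfolding disjoint_family_on_def
    proof (intro ballI impI)
      fix i j assume "i \<in> {..<n}" "j \<in> {..<n}" and ne: "i \<noteq> j"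
      then have ij: "i < n" "j < n" by auto
      then have "e' i \<noteq> e' j"
        using e' ne unfolding n_def bij_betw_def inj_on_def by auto
      moreover have "(fst (e' i), snd (e' i)) \<in> p" "(fst (e' j), snd (e' j)) \<in> p"
        using mem ij qp by auto
      ultimately have "interior (snd (e' i)) \<inter> interior (snd (e' j)) = {}"
        using tagged_division_ofD(5)[OF p, of "fst (e' i)" "snd (e' i)" "fst (e' j)" "snd (e' j)"]
        by (simp add: prod_eq_iff)
      then show "{u i<..<v i} \<inter> {u j<..<v j} = {}"
        using k ij by auto
    qed
    have "ennreal (\<Sum>i<n. v i - u i) = (\<Sum>i<n. emeasure lborel {u i<..<v i})"
      using k by (subst sum_ennreal[symmetric]) auto
    also have "\<dots> = emeasure lborel (\<Union>i<n. {u i<..<v i})"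
      using disj by (intro sum_emeasure) auto
    also have "\<dots> \<le> emeasure lborel U"
    proof (rule emeasure_mono)
      show "(\<Union>i<n. {u i<..<v i}) \<subseteq> U"
      proof safe
        fix i t assume i: "i < n" and t: "t \<in> {u i<..<v i}"
        have "snd (e' i) \<subseteq> U"
          using qU mem[OF i] by (auto simp: case_prod_unfold)
        then show "t \<in> U"
          using k[OF i] t by auto
      qed
    qed (use U in auto)
    also note emU
    finally have "ennreal (\<Sum>i<n. v i - u i) < ennreal d" .
    moreover have "0 \<le> (\<Sum>i<n. v i - u i)"
      using k by (intro sum_nonneg) auto
    ultimately have "(\<Sum>i<n. v i - u i) < d"
      by (simp add: ennreal_less_iff)
    then have "(\<Sum>i<n. norm (x (v i) - x (u i))) < e"
      using k by (intro d disj) auto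
    also have "(\<Sum>i<n. norm (x (v i) - x (u i))) = (\<Sum>tk\<in>q. norm (x (Sup (snd tk)) - x (Inf (snd tk))))"
      unfolding u_def v_def n_def by (rule sum.reindex_bij_betw[OF e'])
    finally show "(\<Sum>(t,k)\<in>q. norm (x (Sup k) - x (Inf k))) < e"
      by (simp add: case_prod_unfold)
  qed
qed

text \<open>The gauge treats two kinds of tags. Off \<open>N\<close> the straddle estimate compares
  each term with the increment of \<open>x\<close>; for tags in \<open>N\<close> the integrand is
  set to 0 and absolute continuity makes the increments small. Integrability of \<open>g\<close>
  comes out as part of the result.\<close>

theorem fundamental_theorem_of_calculus_absolutely_continuous:
  fixes x :: "real \<Rightarrow> 'a::banach"
  assumes "a \<le> b" and ac: "absolutely_continuous_on_interval a b x" and N: "negligible N"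
    and deriv: "\<And>t. t \<in> {a..b} - N \<Longrightarrow> (x has_vector_derivative g t) (at t within {a..b})"
  shows "(g has_integral (x b - x a)) {a..b}"
proof -
  define g' where "g' = (\<lambda>t. if t \<in> N then 0 else g t)"
  have "(g' has_integral (x b - x a)) (cbox a b)"
    unfolding has_integral
  proof (intro allI impI)
    fix e :: real assume "e > 0"
    \<comment> \<open>The \<open>+ 1\<close> keeps the denominator positive when
      \<open>a = b\<close>.\<close>
    define e1 where "e1 = e / (2 * (b - a + 1))"
    have e1: "e1 > 0"
      using \<open>e > 0\<close> \<open>a \<le> b\<close> unfolding e1_def by (intro divide_pos_pos) auto
    have "e1 * (b - a) \<le> e1 * (b - a + 1)"
      using e1 by simp
    also have "\<dots> = e / 2"
      using \<open>a \<le> b\<close> unfolding e1_def by (simp add: divide_simps)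
    finally have e1_le: "e1 * (b - a) \<le> e / 2" .
    obtain U where U: "open U" "N \<subseteq> U" and small:
      "\<forall>q p. q \<subseteq> p \<and> p tagged_division_of {a..b} \<and> (\<forall>(t,k)\<in>q. k \<subseteq> U)
         \<longrightarrow> (\<Sum>(t,k)\<in>q. norm (x (Sup k) - x (Inf k))) < e / 2"
      using absolutely_continuous_small_variation[OF ac N half_gt_zero[OF \<open>e > 0\<close>]]
      by (elim exE conjE) (rule that)
    have "\<exists>d>0. (t \<in> N \<longrightarrow> ball t d \<subseteq> U) \<and> (t \<in> {a..b} - N \<longrightarrow>
        (\<forall>u v. u \<le> t \<and> t \<le> v \<and> {u..v} \<subseteq> {a..b} \<and> {u..v} \<subseteq> ball t d
          \<longrightarrow> norm ((v - u) *\<^sub>R g t - (x v - x u)) \<le> e1 * (v - u)))" for t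
    proof (cases "t \<in> N")
      case True
      then show ?thesis
        using U by (auto simp: open_contains_ball)
    next
      case False
      show ?thesis
      proof (cases "t \<in> {a..b}")
        case True
        with False deriv have "(x has_vector_derivative g t) (at t within {a..b})" by auto
        from has_vector_derivative_straddle[OF this e1] show ?thesis
          using False by metis
      qed (use False zero_less_one in blast)
    qed
    then obtain d where d: "\<And>t. d t > 0" "\<And>t. t \<in> N \<Longrightarrow> ball t (d t) \<subseteq> U"
      "\<And>t u v. \<lbrakk>t \<in> {a..b} - N; u \<le> t; t \<le> v; {u..v} \<subseteq> {a..b}; {u..v} \<subseteq> ball t (d t)\<rbrakk>
          \<Longrightarrow> norm ((v - u) *\<^sub>R g t - (x v - x u)) \<le> e1 * (v - u)"
      by metis
    show "\<exists>\<gamma>. gauge \<gamma> \<and> (\<forall>p. p tagged_division_of cbox a b \<and> \<gamma> fine p \<longrightarrow>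
        norm ((\<Sum>(t,k)\<in>p. measure lborel k *\<^sub>R g' t) - (x b - x a)) < e)"
    proof (intro exI[of _ "\<lambda>t. ball t (d t)"] conjI allI impI)
      show "gauge (\<lambda>t. ball t (d t))"
        using d(1) gauge_ball_dependent by blast
      fix p assume p': "p tagged_division_of cbox a b \<and> (\<lambda>t. ball t (d t)) fine p"
      then have p: "p tagged_division_of {a..b}" and fine: "(\<lambda>t. ball t (d t)) fine p" by auto
      then have fin: "finite p" by blast
      let ?D = "\<lambda>(t,k). measure lborel k *\<^sub>R g' t - (x (Sup k) - x (Inf k))"
      define q where "q = {tk \<in> p. fst tk \<in> N}"
      have ival: "\<exists>u v. k = {u..v} \<and> u \<le> t \<and> t \<le> v \<and> {u..v} \<subseteq> {a..b} \<and> {u..v} \<subseteq> ball t (d t) \<and>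
          measure lborel k = Sup k - Inf k \<and> Inf k = u \<and> Sup k = v" if tk: "(t, k) \<in> p" for t k
      proof -
        obtain u v where "k = {u..v}"
          using tagged_division_ofD(4)[OF p tk] by auto
        then show ?thesis
          using tagged_division_ofD(2,3)[OF p tk] fine tk by (auto simp: fine_def)
      qed
      \<comment> \<open>The increments of \<open>x\<close> over the cells telescope to
        \<open>x b - x a\<close>, so the error can be estimated cell by cell.\<close>
      have "(\<Sum>(t,k)\<in>p. measure lborel k *\<^sub>R g' t) - (x b - x a) = sum ?D p"
        using additive_tagged_division_1[OF \<open>a \<le> b\<close> p, of x]
        by (simp add: case_prod_unfold sum_subtractf)
      also have "\<dots> = sum ?D q + sum ?D (p - q)"
        using fin sum.subset_diff[of q p ?D] by (simp add: q_def add.commute)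
      also have "norm \<dots> \<le> (\<Sum>tk\<in>q. norm (?D tk)) + (\<Sum>tk\<in>p - q. norm (?D tk))"
        by (rule order_trans[OF norm_triangle_ineq add_mono[OF norm_sum norm_sum]])
      also have "(\<Sum>tk\<in>q. norm (?D tk)) = (\<Sum>(t,k)\<in>q. norm (x (Sup k) - x (Inf k)))"
        unfolding q_def g'_def by (rule sum.cong) (auto simp: norm_minus_commute)
      also have "\<dots> < e / 2"
      proof (rule small[rule_format, of q p], intro conjI p)
        show "\<forall>(t,k)\<in>q. k \<subseteq> U"
        proof clarify
          fix t k s assume "(t, k) \<in> q" "s \<in> k"
          then show "s \<in> U"
            using ival[of t k] d(2)[of t] unfolding q_def by auto
        qed
      qed (auto simp: q_def)
      also have "(\<Sum>tk\<in>p - q. norm (?D tk)) \<le> (\<Sum>(t,k)\<in>p - q. e1 * (Sup k - Inf k))"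
      proof (rule sum_mono, clarify)
        fix t k assume tk: "(t, k) \<in> p" "(t, k) \<notin> q"
        then have "t \<notin> N"
          by (simp add: q_def)
        obtain u v where uv: "k = {u..v}" "u \<le> t" "t \<le> v" "{u..v} \<subseteq> {a..b}" "{u..v} \<subseteq> ball t (d t)"
          using ival[OF tk(1)] by blast
        moreover have "t \<in> {u..v}"
          using uv by simp
        ultimately show "norm (measure lborel k *\<^sub>R g' t - (x (Sup k) - x (Inf k))) \<le> e1 * (Sup k - Inf k)"
          using \<open>t \<notin> N\<close> d(3)[of t u v] by (simp add: g'_def subset_iff del: atLeastAtMost_iff)
      qed
      also have "\<dots> \<le> (\<Sum>(t,k)\<in>p. e1 * (Sup k - Inf k))"
      proof (rule sum_mono2[OF fin])
        fix tk assume "tk \<in> p - (p - q)"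
        then show "0 \<le> (case tk of (t, k) \<Rightarrow> e1 * (Sup k - Inf k))"
          using ival[of "fst tk" "snd tk"] e1 by (auto simp: case_prod_unfold)
      qed auto
      also have "\<dots> = e1 * (b - a)"
        using additive_tagged_division_1[OF \<open>a \<le> b\<close> p, of "\<lambda>t. t"]
        by (simp add: case_prod_unfold sum_distrib_left[symmetric])
      finally show "norm ((\<Sum>(t,k)\<in>p. measure lborel k *\<^sub>R g' t) - (x b - x a)) < e"
        using e1_le by linarith
    qed
  qed
  then show ?thesis
    unfolding box_real g'_def
    by (rule has_integral_spike[OF N, rotated]) auto
qed

section \<open>Right-continuous functions and switching signals\<close>

lemma AE_interval_ex:
  fixes a b :: real
  assumes "AE t in lborel. P t" "a < b"
  obtains t where "a < t" "t < b" "P t"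
proof -
  obtain N where N: "\<And>t. t \<notin> N \<Longrightarrow> P t" "N \<in> null_sets lborel"
    using assms(1) by (rule AE_E3) auto
  have "\<not> {a<..<b} \<subseteq> N"
  proof
    assume "{a<..<b} \<subseteq> N"
    then have "emeasure lborel {a<..<b} \<le> emeasure lborel N"
      using N(2) by (intro emeasure_mono) auto
    then show False
      using N(2) \<open>a < b\<close> by (auto simp: null_sets_def)
  qed
  then obtain t where "t \<in> {a<..<b}" "t \<notin> N"
    by blast
  with N(1) that show thesis
    by auto
qed

text \<open>A value outside \<open>C\<close> would persist on an interval to the right of
  \<open>t\<close>, which has positive measure. This turns almost-everywhere facts about limit
  signals into facts at every time.\<close>

lemma right_continuous_AE_in_closed:
  fixes F :: "real \<Rightarrow> 'a::topological_space"
  assumes "continuous (at_right t) F" "closed C" "AE s in lborel. F s \<in> C"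
  shows "F t \<in> C"
proof (rule ccontr)
  assume "F t \<notin> C"
  then have "eventually (\<lambda>s. F s \<in> - C) (at_right t)"
    using assms(1,2) topological_tendstoD[of F "F t" "at_right t" "- C"]
    by (auto simp: continuous_within open_Compl)
  then obtain b where "b > t" "\<And>s. \<lbrakk>t < s; s < b\<rbrakk> \<Longrightarrow> F s \<notin> C"
    unfolding eventually_at_right_field by auto
  then show False
    using AE_interval_ex[OF assms(3)] by metis
qed

lemma AE_lborel_shift:
  fixes s :: real
  assumes "AE t in lborel. P t"
  shows "AE t in lborel. P (t + s)"
proof -
  obtain N where N: "\<And>t. t \<notin> N \<Longrightarrow> P t" "N \<in> null_sets lborel"
    using assms by (rule AE_E3) auto
  have "AE t in lborel. s + 1 * t \<notin> N"
    using N(2) by (intro AE_borel_affine AE_not_in) auto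
  then show ?thesis
    by eventually_elim (auto intro: N(1) simp: add.commute)
qed

lemma continuous_at_right_shift:
  fixes F :: "real \<Rightarrow> 'a::topological_space"
  assumes "continuous (at_right (t + s)) F"
  shows "continuous (at_right t) (\<lambda>u. F (u + s))"
proof (rule continuous_within_compose2)
  have "(\<lambda>u. u + s) ` {t<..} = {t + s<..}"
    by (auto simp: image_iff intro!: bexI[of _ "_ - s"])
  then show "continuous (at (t + s) within (\<lambda>u. u + s) ` {t<..}) F"
    using assms by simp
qed (intro continuous_intros)

text \<open>A three-epsilon argument: moving to a nearby rational costs at most a third of the
  tolerance, uniformly in \<open>n\<close>. It stands in for Arzela-Ascoli, as pointwise limits of
  the states suffice here.\<close>

lemma convergent_of_dense_Lipschitz:
  fixes F :: "nat \<Rightarrow> real \<Rightarrow> 'a::complete_space"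
  assumes lip: "\<And>n s t. dist (F n s) (F n t) \<le> L * \<bar>s - t\<bar>"
    and conv: "\<And>q. q \<in> \<rat> \<Longrightarrow> convergent (\<lambda>n. F n q)"
  shows "convergent (\<lambda>n. F n t)"
proof -
  have "Cauchy (\<lambda>n. F n t)"
  proof (rule metric_CauchyI)
    fix e :: real assume "e > 0"
    \<comment> \<open>\<open>\<bar>L\<bar> + 1\<close> is positive whatever the sign of
      \<open>L\<close>.\<close>
    define d where "d = e / (3 * (\<bar>L\<bar> + 1))"
    have "d > 0"
      using \<open>e > 0\<close> unfolding d_def by (intro divide_pos_pos) auto
    then obtain q where q: "q \<in> \<rat>" "t < q" "q < t + d"
      using Rats_dense_in_real[of t "t + d"] by auto
    have "L * \<bar>t - q\<bar> \<le> (\<bar>L\<bar> + 1) * d"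
      using q by (intro mult_mono) auto
    also have "\<dots> = e / 3"
      unfolding d_def by (simp add: field_simps)
    finally have close: "dist (F n t) (F n q) \<le> e / 3" for n
      using lip[of n t q] by linarith
    obtain M where M: "\<And>m n. \<lbrakk>m \<ge> M; n \<ge> M\<rbrakk> \<Longrightarrow> dist (F m q) (F n q) < e / 3"
      using convergent_Cauchy[OF conv[OF q(1)]] \<open>e > 0\<close> metric_CauchyD[of _ "e / 3"]
      by (metis zero_less_divide_iff zero_less_numeral)
    show "\<exists>M. \<forall>m\<ge>M. \<forall>n\<ge>M. dist (F m t) (F n t) < e"
    proof (intro exI allI impI)
      fix m n assume "M \<le> m" "M \<le> n"
      then have "dist (F m q) (F n q) < e / 3"
        using M by blast
      moreover have "dist (F m t) (F n t) \<le> dist (F m t) (F m q) + dist (F m q) (F n q) + dist (F n t) (F n q)"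
        by (metis add_mono_thms_linordered_semiring(3) dist_commute dist_triangle order_trans)
      ultimately show "dist (F m t) (F n t) < e"
        using close[of m] close[of n] by linarith
    qed
  qed
  then show ?thesis
    by (rule Cauchy_convergent)
qed

lemma dist_Pair_le_sum: "dist (a, b) (c, d) \<le> dist a c + dist b d"
  unfolding dist_Pair_Pair by (intro sqrt_sum_squares_le_sum) auto

text \<open>Pigeonhole: a jump in each of the \<open>m\<close> disjoint cells would exceed the
  dwell-time bound on \<open>{a<..<b}\<close>. The number \<open>m\<close> can be chosen before the
  signal, so the cell length is uniform over the whole family.\<close>

lemma average_dwell_jump_free_cell:
  assumes \<sigma>: "\<sigma> \<in> average_dwell_signals \<Gamma> \<tau> N" and "\<tau> > 0" "a < b"
    and m: "real N + (b - a) / \<tau> < real m"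
  obtains i where "i < m"
    "jump_times \<sigma> \<inter> {a + real i * ((b - a) / m)<..<a + real (Suc i) * ((b - a) / m)} = {}"
proof (rule ccontr)
  define w where "w = (b - a) / m"
  define J where "J = (\<lambda>i. {a + real i * w<..<a + real (Suc i) * w})"
  assume "\<not> thesis"
  then have "\<forall>i<m. \<exists>t. t \<in> jump_times \<sigma> \<inter> J i"
    using that unfolding w_def J_def by blast
  then obtain j where j: "\<And>i. i < m \<Longrightarrow> j i \<in> jump_times \<sigma> \<inter> J i"
    by metis
  \<comment> \<open>The case \<open>m = 0\<close> must be excluded, since division by zero would
    give cells of width 0.\<close>
  have "0 \<le> real N + (b - a) / \<tau>"
    using \<open>\<tau> > 0\<close> \<open>a < b\<close> by (intro add_nonneg_nonneg divide_nonneg_pos) auto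
  with m have "m > 0" by (cases "m = 0") auto
  with \<open>a < b\<close> have w: "w > 0" "real m * w = b - a"
    unfolding w_def by auto
  have less: "j i < j i'" if "i < i'" "i' < m" for i i'
  proof -
    have "j i < a + real (Suc i) * w"
      using j[of i] that by (auto simp: J_def)
    also have "\<dots> \<le> a + real i' * w"
      using that w by (intro add_left_mono mult_right_mono) auto
    also have "\<dots> < j i'"
      using j[of i'] that by (auto simp: J_def)
    finally show ?thesis .
  qed
  have "inj_on j {..<m}"
    using less by (intro linorder_inj_onI') force
  then have "m = card (j ` {..<m})"
    by (simp add: card_image)
  also have "\<dots> \<le> card (jump_times \<sigma> \<inter> {a<..<b})"
  proof (rule card_mono)
    \<comment> \<open>Finiteness matters because \<open>card\<close> of an infinite set is
      0.\<close>
    have "finite (jump_times \<sigma> \<inter> {a..b})"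
      using \<sigma> by (simp add: average_dwell_signals_def switching_signal_def)
    then show "finite (jump_times \<sigma> \<inter> {a<..<b})"
      by (rule rev_finite_subset) auto
    have "J i \<subseteq> {a<..<b}" if "i < m" for i
    proof -
      have "real (Suc i) * w \<le> real m * w"
        using that w(1) by (intro mult_right_mono) auto
      moreover have "0 \<le> real i * w"
        using w(1) by (intro mult_nonneg_nonneg) auto
      ultimately show ?thesis
        using w(2) unfolding J_def greaterThanLessThan_def
        by (intro subsetI) (simp only: Int_iff greaterThan_iff lessThan_iff, linarith)
    qed
    then show "j ` {..<m} \<subseteq> jump_times \<sigma> \<inter> {a<..<b}"
      using j by blast
  qed
  finally have "real m \<le> real (card (jump_times \<sigma> \<inter> {a<..<b}))"
    by simp
  also have "\<dots> \<le> real N + (b - a) / \<tau>"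
    using \<sigma> \<open>a < b\<close> unfolding average_dwell_signals_def by blast
  finally show False
    using m by simp
qed

lemma switching_signal_eq_if_no_jump:
  assumes "switching_signal \<Gamma> \<sigma>" "jump_times \<sigma> \<inter> {a<..<b} = {}" "s \<in> {a<..<b}" "t \<in> {a<..<b}"
  shows "\<sigma> s = \<sigma> t"
proof -
  have "\<sigma> constant_on {a<..<b}"
    using assms(1,2) unfolding switching_signal_def by (metis Int_commute is_interval_oo)
  then show ?thesis
    using assms(3,4) unfolding constant_on_def by metis
qed

text \<open>Intervals of length \<open>w\<close> are chosen one after another, each starting beyond
  the end of the previous one. This gives a disjoint family with measures bounded below on which the
  infima stay above \<open>c\<close>.\<close>

lemma not_weakly_meagreI:
  assumes "c > 0" "w > 0" and large: "\<And>T. \<exists>a\<ge>T. \<forall>t\<in>{a<..<a + w}. c \<le> \<bar>y t\<bar>"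
  shows "\<not> weakly_meagre y"
proof
  assume wm: "weakly_meagre y"
  define P where "P = (\<lambda>a. 0 \<le> a \<and> (\<forall>t\<in>{a<..<a + w}. c \<le> \<bar>y t\<bar>))"
  have ex: "\<exists>a\<ge>T. P a" for T
  proof -
    obtain a where "a \<ge> max 0 T" "\<forall>t\<in>{a<..<a + w}. c \<le> \<bar>y t\<bar>"
      using large[of "max 0 T"] by blast
    then show ?thesis
      unfolding P_def by (intro exI[of _ a]) auto
  qed
  have "\<exists>A. \<forall>k. P (A k) \<and> A k + w \<le> A (Suc k)"
    by (rule dependent_nat_choice) (use ex in blast)+
  then obtain A where A: "\<And>k. P (A k)" "\<And>k. A k + w \<le> A (Suc k)"
    by blast
  have mono: "A k + w \<le> A l" if "k < l" for k l
    using that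
  proof (induction l)
    case (Suc l)
    then show ?case
      using A(2)[of l] \<open>w > 0\<close> by (cases "k = l") auto
  qed simp
  define J where "J = (\<lambda>k. {A k<..<A k + w})"
  have "disjoint_family J"
    unfolding disjoint_family_on_def
  proof (intro ballI impI)
    fix k l :: nat assume "k \<noteq> l"
    then show "J k \<inter> J l = {}"
      using mono[of k l] mono[of l k] by (cases "k < l") (auto simp: J_def)
  qed
  moreover have "J k \<noteq> {}" "is_interval (J k)" "J k \<subseteq> {0..}" for k
    using A(1)[of k] \<open>w > 0\<close> by (auto simp: J_def P_def is_interval_oo)
  moreover have "(INF k. emeasure lborel (J k)) > 0"
    using \<open>w > 0\<close> by (simp add: J_def)
  ultimately have "(\<lambda>k. INF t\<in>J k. \<bar>y t\<bar>) \<longlonglongrightarrow> 0"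
    using wm unfolding weakly_meagre_def by blast
  moreover have "c \<le> (INF t\<in>J k. \<bar>y t\<bar>)" for k
    using A(1)[of k] \<open>J k \<noteq> {}\<close> by (intro cINF_greatest) (auto simp: P_def J_def)
  ultimately show False
    using \<open>c > 0\<close> LIMSEQ_le_const[of _ 0 c] by (metis not_le)
qed

section \<open>Trajectories and invariant sets\<close>

lemma lipschitz_imp_absolutely_continuous:
  fixes x :: "real \<Rightarrow> 'a::real_normed_vector"
  assumes "\<And>s t. dist (x s) (x t) \<le> L * \<bar>s - t\<bar>"
  shows "absolutely_continuous_on_interval a b x"
  unfolding absolutely_continuous_on_interval_def
proof (intro allI impI)
  fix e :: real assume "e > 0"
  define d where "d = e / (\<bar>L\<bar> + 1)"
  have d: "d > 0" "(\<bar>L\<bar> + 1) * d = e"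
    using \<open>e > 0\<close> unfolding d_def by (auto intro!: divide_pos_pos)
  have "(\<Sum>i<n. norm (x (v i) - x (u i))) < e"
    if uv: "\<forall>i<n. a \<le> u i \<and> u i \<le> v i \<and> v i \<le> b" and "(\<Sum>i<n. v i - u i) < d"
    for n :: nat and u v
  proof -
    have "norm (x (v i) - x (u i)) \<le> (\<bar>L\<bar> + 1) * (v i - u i)" if "i < n" for i
    proof -
      have "norm (x (v i) - x (u i)) \<le> L * \<bar>v i - u i\<bar>"
        using assms[of "v i" "u i"] by (simp add: dist_norm)
      also have "\<dots> \<le> (\<bar>L\<bar> + 1) * \<bar>v i - u i\<bar>"
        by (intro mult_right_mono) auto
      finally show ?thesis
        using uv that by auto
    qed
    then have "(\<Sum>i<n. norm (x (v i) - x (u i))) \<le> (\<bar>L\<bar> + 1) * (\<Sum>i<n. v i - u i)"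
      unfolding sum_distrib_left by (intro sum_mono) auto
    also have "\<dots> < (\<bar>L\<bar> + 1) * d"
      using that(2) by (intro mult_strict_left_mono) auto
    finally show ?thesis
      using d(2) by simp
  qed
  then show "\<exists>\<delta>>0. \<forall>(n::nat) u v.
      (\<forall>i<n. a \<le> u i \<and> u i \<le> v i \<and> v i \<le> b) \<and>
      disjoint_family_on (\<lambda>i. {u i<..<v i}) {..<n} \<and> (\<Sum>i<n. v i - u i) < \<delta>
      \<longrightarrow> (\<Sum>i<n. norm (x (v i) - x (u i))) < e"
    using d(1) by blast
qed

text \<open>The derivative exists only almost everywhere, so the passage to the integral form rests
  on absolute continuity.\<close>

lemma trajectory_has_integral:
  assumes "trajectory \<Gamma> D f I x \<sigma>" "{a..b} \<subseteq> I" "a \<le> b"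
  shows "((\<lambda>t. f (x t, \<sigma> t)) has_integral (x b - x a)) {a..b}"
proof -
  have "AE t in lborel. t \<in> I \<longrightarrow> (x has_vector_derivative f (x t, \<sigma> t)) (at t within I)"
    using assms(1) by (simp add: trajectory_def)
  then obtain N where N: "\<And>t. \<lbrakk>t \<notin> N; t \<in> I\<rbrakk> \<Longrightarrow> (x has_vector_derivative f (x t, \<sigma> t)) (at t within I)"
    "N \<in> null_sets lborel"
    by (rule AE_E3) auto
  have "absolutely_continuous_on_interval a b x"
    using assms by (auto simp: trajectory_def locally_absolutely_continuous_on_def)
  then show ?thesis
  proof (rule fundamental_theorem_of_calculus_absolutely_continuous[OF assms(3)])
    show "negligible N"
      using N(2) by (simp add: negligible_iff_null_sets null_sets_completionI)
    show "(x has_vector_derivative f (x t, \<sigma> t)) (at t within {a..b})" if "t \<in> {a..b} - N" for t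
      using N(1)[of t] that assms(2) has_vector_derivative_within_subset by blast
  qed
qed

text \<open>The way back from the integral form: between jumps the integrand is continuous and the
  integral can be differentiated, while the jump times form a null set. The Lipschitz bound supplies
  absolute continuity.\<close>

lemma complete_trajectoryI:
  assumes \<sigma>: "switching_signal \<Gamma> \<sigma>" and D: "\<And>t. (x t, \<sigma> t) \<in> D" and f: "continuous_on D f"
    and lip: "\<And>s t. dist (x s) (x t) \<le> L * \<bar>s - t\<bar>"
    and int: "\<And>a b. a \<le> b \<Longrightarrow> ((\<lambda>t. f (x t, \<sigma> t)) has_integral (x b - x a)) {a..b}"
  shows "trajectory \<Gamma> D f UNIV x \<sigma>"
proof -
  let ?g = "\<lambda>t. f (x t, \<sigma> t)"
  have "isCont x t" for t
    unfolding continuous_at_eps_delta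
  proof (intro allI impI)
    fix e :: real assume "e > 0"
    show "\<exists>d>0. \<forall>s. dist s t < d \<longrightarrow> dist (x s) (x t) < e"
    proof (intro exI conjI allI impI)
      show "e / (\<bar>L\<bar> + 1) > 0"
        using \<open>e > 0\<close> by (intro divide_pos_pos) auto
      fix s assume "dist s t < e / (\<bar>L\<bar> + 1)"
      then have "(\<bar>L\<bar> + 1) * \<bar>s - t\<bar> < e"
        by (simp add: dist_real_def field_simps add_pos_nonneg)
      moreover have "L * \<bar>s - t\<bar> \<le> (\<bar>L\<bar> + 1) * \<bar>s - t\<bar>"
        by (intro mult_right_mono) auto
      ultimately show "dist (x s) (x t) < e"
        using lip[of s t] by linarith
    qed
  qed
  have deriv: "(x has_vector_derivative ?g t) (at t)" if "t \<notin> jump_times \<sigma>" for t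
  proof -
    have "isCont \<sigma> t"
      using that by (simp add: jump_times_def)
    have "continuous (at (x t, \<sigma> t) within D) f"
      using f D by (simp add: continuous_on_eq_continuous_within)
    then have "continuous (at (x t, \<sigma> t) within range (\<lambda>t. (x t, \<sigma> t))) f"
      by (rule continuous_within_subset) (use D in auto)
    with continuous_Pair[OF \<open>isCont x t\<close> \<open>isCont \<sigma> t\<close>] have cont: "isCont ?g t"
      by (rule continuous_within_compose2)
    \<comment> \<open>The base point \<open>t - 1\<close> puts \<open>t\<close> in the interior of
      \<open>{t - 1..t + 1}\<close>, so that the derivative within this interval becomes a two-sided
      one.\<close>
    have "((\<lambda>u. integral {t - 1..u} ?g) has_vector_derivative ?g t) (at t within {t - 1..t + 1} - {})"
    proof (rule integral_has_vector_derivative_continuous_at)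
      show "?g integrable_on {t - 1..t + 1}"
        using int[of "t - 1" "t + 1"] by auto
    qed (use cont continuous_at_imp_continuous_at_within in auto)
    then have "((\<lambda>u. integral {t - 1..u} ?g) has_vector_derivative ?g t) (at t within {t - 1..t + 1})"
      by simp
    then have "((\<lambda>u. x u - x (t - 1)) has_vector_derivative ?g t) (at t within {t - 1..t + 1})"
    proof (rule has_vector_derivative_transform[rotated 2])
      show "x u - x (t - 1) = integral {t - 1..u} ?g" if "u \<in> {t - 1..t + 1}" for u
        using int[of "t - 1" u] that by (auto simp: integral_unique)
    qed auto
    then have "((\<lambda>u. x u - x (t - 1)) has_vector_derivative ?g t) (at t)"
      by (simp add: at_within_Icc_at)
    then have "((\<lambda>u. (x u - x (t - 1)) + x (t - 1)) has_vector_derivative ?g t + 0) (at t)"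
      by (intro has_vector_derivative_add has_vector_derivative_const)
    then show ?thesis by simp
  qed
  \<comment> \<open>Finitely many jumps in each bounded interval make the jump set countable, hence
    null.\<close>
  have "jump_times \<sigma> = (\<Union>n. jump_times \<sigma> \<inter> {- real n..real n})"
  proof safe
    fix t assume "t \<in> jump_times \<sigma>"
    moreover obtain n :: nat where "\<bar>t\<bar> \<le> real n"
      using real_arch_simple by blast
    ultimately show "t \<in> (\<Union>n. jump_times \<sigma> \<inter> {- real n..real n})"
      by (auto simp: abs_le_iff intro!: exI[of _ n])
  qed
  moreover have "countable (\<Union>n. jump_times \<sigma> \<inter> {- real n..real n})"
    using \<sigma> by (intro countable_UN countableI_type) (simp add: switching_signal_def countable_finite)
  ultimately have "countable (jump_times \<sigma>)"
    by metis
  then have "AE t in lborel. t \<notin> jump_times \<sigma>"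
    by (intro AE_not_in countable_imp_null_set_lborel)
  then have "AE t in lborel. t \<in> UNIV \<longrightarrow> (x has_vector_derivative ?g t) (at t)"
    by eventually_elim (use deriv in auto)
  then show ?thesis
    using \<sigma> D lipschitz_imp_absolutely_continuous[OF lip]
    by (simp add: trajectory_def locally_absolutely_continuous_on_def)
qed

text \<open>Unions of weakly invariant sets are weakly invariant, so the union of all those inside
  \<open>A\<close> is the maximal one. As weak invariance includes nonemptiness, the witness
  \<open>W\<close> is what makes this family of sets nonempty.\<close>

lemma maximal_weakly_invariant_in_unique_ex:
  assumes "weakly_invariant T W" "W \<subseteq> A"
  shows "\<exists>!M. maximal_weakly_invariant_in T A M"
    and "maximal_weakly_invariant_in T A M \<Longrightarrow> W \<subseteq> M"
proof -
  have Union: "weakly_invariant T (\<Union>\<C>)"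
    if ne: "\<C> \<noteq> {}" and inv: "\<And>N. N \<in> \<C> \<Longrightarrow> weakly_invariant T N" for \<C>
    unfolding weakly_invariant_def
  proof safe
    assume "\<Union>\<C> = {}"
    moreover obtain N where "N \<in> \<C>"
      using ne by blast
    ultimately show False
      using inv[of N] by (auto simp: weakly_invariant_def)
  next
    fix \<xi> \<gamma> N assume "N \<in> \<C>" "(\<xi>, \<gamma>) \<in> N"
    then obtain x \<sigma> where "(x, \<sigma>) \<in> T" "x 0 = \<xi>" "\<sigma> 0 = \<gamma>" "\<forall>t. (x t, \<sigma> t) \<in> N"
      using inv[OF \<open>N \<in> \<C>\<close>] by (fastforce simp: weakly_invariant_def)
    then show "\<exists>(x, \<sigma>)\<in>T. x 0 = \<xi> \<and> \<sigma> 0 = \<gamma> \<and> (\<forall>t. (x t, \<sigma> t) \<in> \<Union>\<C>)"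
      using \<open>N \<in> \<C>\<close> by (intro bexI[of _ "(x, \<sigma>)"]) auto
  qed
  \<comment> \<open>Maximality for inclusion already makes \<open>M\<close> the greatest such set,
    because \<open>M \<union> N\<close> is a competitor for \<open>M\<close>.\<close>
  have sub: "N \<subseteq> M" if "maximal_weakly_invariant_in T A M" "weakly_invariant T N" "N \<subseteq> A" for M N
  proof -
    have "weakly_invariant T (\<Union>{M, N})"
      using that by (intro Union) (auto simp: maximal_weakly_invariant_in_def)
    then have "weakly_invariant T (M \<union> N)"
      by simp
    then have "M \<union> N = M"
      using that unfolding maximal_weakly_invariant_in_def by (metis Un_least Un_upper1)
    then show ?thesis by blast
  qed
  show "W \<subseteq> M" if "maximal_weakly_invariant_in T A M"
    using sub[OF that assms] .
  let ?\<C> = "{N. weakly_invariant T N \<and> N \<subseteq> A}"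
  have "weakly_invariant T (\<Union>?\<C>)"
    using assms by (intro Union) auto
  then have "maximal_weakly_invariant_in T A (\<Union>?\<C>)"
    unfolding maximal_weakly_invariant_in_def by blast
  moreover have "M = M'" if "maximal_weakly_invariant_in T A M" "maximal_weakly_invariant_in T A M'" for M M'
    using sub[OF that(1)] sub[OF that(2)] that
    by (simp add: maximal_weakly_invariant_in_def subset_antisym)
  ultimately show "\<exists>!M. maximal_weakly_invariant_in T A M"
    by blast
qed

section \<open>Limits of translates of a precompact trajectory\<close>

text \<open>The states converge at every time, the signals only almost everywhere, which is the mode
  of convergence that property P provides.\<close>

definition translates_converge ::
    "(real \<Rightarrow> 'a::topological_space) \<Rightarrow> (real \<Rightarrow> 'g::topological_space) \<Rightarrow> (nat \<Rightarrow> real) \<Rightarrow>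
     (real \<Rightarrow> 'a) \<Rightarrow> (real \<Rightarrow> 'g) \<Rightarrow> bool"
  where "translates_converge x \<sigma> \<tau> z \<rho> \<longleftrightarrow>
    filterlim \<tau> at_top sequentially \<and> (\<forall>t. (\<lambda>k. x (t + \<tau> k)) \<longlonglongrightarrow> z t) \<and>
    (AE t in lborel. (\<lambda>k. \<sigma> (t + \<tau> k)) \<longlonglongrightarrow> \<rho> t)"

locale precompact_trajectory =
  fixes \<Gamma> :: "'g::metric_space set"
    and D :: "((real^'n) \<times> 'g) set"
    and f :: "(real^'n) \<times> 'g \<Rightarrow> real^'n"
    and S :: "(real \<Rightarrow> 'g) set"
    and I :: "real set"
    and x :: "real \<Rightarrow> real^'n"
    and \<sigma> :: "real \<Rightarrow> 'g"
    and K :: "((real^'n) \<times> 'g) set"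
  assumes closed_D: "closed D" and cont_f: "continuous_on D f"
    and prop_P: "property_P \<Gamma> S"
    and \<sigma>_in: "\<sigma> \<in> S" and traj: "trajectory \<Gamma> D f I x \<sigma>" and I_ge_0: "{0..} \<subseteq> I"
    and compact_K: "compact K" and in_K: "\<And>t. 0 \<le> t \<Longrightarrow> (x t, \<sigma> t) \<in> K"
begin

lemma signal_switching: "\<rho> \<in> S \<Longrightarrow> switching_signal \<Gamma> \<rho>"
  using prop_P by (auto simp: property_P_def average_dwell_signals_def)

lemma signal_right_continuous: "\<rho> \<in> S \<Longrightarrow> continuous (at_right t) \<rho>"
  using signal_switching by (auto simp: switching_signal_def)

lemma translate_in_S: "s > 0 \<Longrightarrow> (\<lambda>t. \<sigma> (t + s)) \<in> S"
  using prop_P \<sigma>_in by (auto simp: property_P_def)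

lemma signal_compactness:
  assumes "\<And>k. \<sigma>s k \<in> S"
  obtains \<rho> r where "\<rho> \<in> S" "strict_mono (r :: nat \<Rightarrow> nat)"
    "AE t in lborel. (\<lambda>l. \<sigma>s (r l) t) \<longlonglongrightarrow> \<rho> t"
  using prop_P assms unfolding property_P_def by metis

lemma in_D: "0 \<le> t \<Longrightarrow> (x t, \<sigma> t) \<in> D"
  using traj I_ge_0 by (auto simp: trajectory_def)

lemma compact_K_D: "compact (K \<inter> D)"
  using compact_K closed_D by (rule compact_Int_closed)

lemma field_bounded: "\<exists>L>0. \<forall>p\<in>K \<inter> D. norm (f p) \<le> L"
proof -
  have "bounded (f ` (K \<inter> D))"
    using compact_K_D cont_f
    by (intro compact_imp_bounded compact_continuous_image) (auto intro: continuous_on_subset)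
  then show ?thesis
    unfolding bounded_pos by auto
qed

text \<open>A single constant is fixed because it serves three times: as Lipschitz constant of
  \<open>x\<close> on the nonnegative times, as that of every limit, and as the dominating function
  in the limit of the integrals.\<close>

definition L where "L = (SOME L. L > 0 \<and> (\<forall>p\<in>K \<inter> D. norm (f p) \<le> L))"

lemma L_pos: "L > 0" and field_le_L: "p \<in> K \<inter> D \<Longrightarrow> norm (f p) \<le> L"
  using someI_ex[OF field_bounded] by (auto simp: L_def)

lemma x_Lipschitz:
  assumes "0 \<le> s" "0 \<le> t"
  shows "dist (x s) (x t) \<le> L * \<bar>s - t\<bar>"
proof -
  have *: "dist (x b) (x a) \<le> L * (b - a)" if "0 \<le> a" "a \<le> b" for a b
  proof -
    have "((\<lambda>t. f (x t, \<sigma> t)) has_integral (x b - x a)) (cbox a b)"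
      using trajectory_has_integral[OF traj, of a b] I_ge_0 that by fastforce
    then have "norm (x b - x a) \<le> L * measure lborel (cbox a b)"
      using L_pos that field_le_L in_K in_D by (intro has_integral_bound) auto
    then show ?thesis
      using that by (simp add: dist_norm)
  qed
  show ?thesis
    using *[of s t] *[of t s] assms by (cases "s \<le> t") (auto simp: dist_commute)
qed

lemma eventually_translate_ge_0:
  fixes \<tau> :: "nat \<Rightarrow> real"
  assumes "filterlim \<tau> at_top sequentially"
  shows "eventually (\<lambda>k. 0 \<le> t + \<tau> k) sequentially"
proof -
  have "eventually (\<lambda>k. - t \<le> \<tau> k) sequentially"
    using assms by (simp add: filterlim_at_top)
  then show ?thesis
    by eventually_elim simp
qed

text \<open>Two extractions: a diagonal one makes the states converge at rational times, hence at
  all times by the common Lipschitz bound; property P then makes the signals converge along a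
  further subsequence.\<close>

lemma translates_converge_subseq:
  fixes \<tau> :: "nat \<Rightarrow> real"
  assumes \<tau>: "filterlim \<tau> at_top sequentially"
  obtains r z \<rho> where "strict_mono r" "\<rho> \<in> S" "translates_converge x \<sigma> (\<tau> \<circ> r) z \<rho>"
proof -
  \<comment> \<open>For small \<open>k\<close> the time \<open>t + \<tau> k\<close> may be negative,
    where \<open>x\<close> is not controlled by \<open>K\<close>. Truncation at 0 keeps
    \<open>F\<close> bounded and Lipschitz, and for each \<open>t\<close> it has no effect once
    \<open>k\<close> is large.\<close>
  define F where "F = (\<lambda>k t. x (max 0 (t + \<tau> k)))"
  have "bounded (fst ` K)"
    using compact_K by (intro compact_imp_bounded compact_continuous_image continuous_intros)
  then obtain B where "\<And>p. p \<in> K \<Longrightarrow> norm (fst p) \<le> B"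
    unfolding bounded_iff by auto
  then have B: "norm (x t) \<le> B" if "t \<ge> 0" for t
    using in_K[OF that] by fastforce
  then have "norm (F k t) \<le> B" for k t
    unfolding F_def by simp
  then obtain r1 where r1: "strict_mono (r1 :: nat \<Rightarrow> nat)"
      "\<And>q. q \<in> \<rat> \<Longrightarrow> \<exists>l. (\<lambda>n. F (r1 n) q) \<longlonglongrightarrow> l"
    using function_convergent_subsequence[OF countable_rat, of F B] by blast
  have F_lip: "dist (F k s) (F k t) \<le> L * \<bar>s - t\<bar>" for k s t
  proof -
    have "dist (F k s) (F k t) \<le> L * \<bar>max 0 (s + \<tau> k) - max 0 (t + \<tau> k)\<bar>"
      unfolding F_def by (rule x_Lipschitz) auto
    also have "\<dots> \<le> L * \<bar>s - t\<bar>"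
      using L_pos by (intro mult_left_mono) auto
    finally show ?thesis .
  qed
  have "convergent (\<lambda>n. F (r1 n) t)" for t
    by (rule convergent_of_dense_Lipschitz[of "\<lambda>n. F (r1 n)" L])
      (use F_lip r1(2) in \<open>auto simp: convergent_def\<close>)
  then obtain z where z: "\<And>t. (\<lambda>n. F (r1 n) t) \<longlonglongrightarrow> z t"
    unfolding convergent_def by metis
  have "filterlim (\<tau> \<circ> r1) at_top sequentially"
    unfolding comp_def by (rule filterlim_compose[OF \<tau> filterlim_subseq[OF r1(1)]])
  \<comment> \<open>Property P gives translates by positive times only, so the first
    \<open>k0\<close> indices are dropped; \<open>r3\<close> restores this offset.\<close>
  then obtain k0 where k0: "\<And>k. k \<ge> k0 \<Longrightarrow> \<tau> (r1 k) > 0"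
    unfolding filterlim_at_top_dense eventually_sequentially comp_def by blast
  have "(\<lambda>t. \<sigma> (t + \<tau> (r1 (k + k0)))) \<in> S" for k
    by (intro translate_in_S k0) simp
  then obtain \<rho> r2 where \<rho>: "\<rho> \<in> S" "strict_mono (r2 :: nat \<Rightarrow> nat)"
    "AE t in lborel. (\<lambda>l. \<sigma> (t + \<tau> (r1 (r2 l + k0)))) \<longlonglongrightarrow> \<rho> t"
    by (rule signal_compactness[of "\<lambda>k t. \<sigma> (t + \<tau> (r1 (k + k0)))"])
  define r3 where "r3 = (\<lambda>l. r2 l + k0)"
  define r where "r = r1 \<circ> r3"
  have r3: "strict_mono r3"
    using \<rho>(2) by (simp add: r3_def strict_mono_def)
  then have r: "strict_mono r"
    using r1(1) unfolding r_def by (rule strict_mono_o[rotated])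
  have lim: "filterlim (\<tau> \<circ> r) at_top sequentially"
    unfolding comp_def by (rule filterlim_compose[OF \<tau> filterlim_subseq[OF r]])
  have "(\<lambda>k. x (t + (\<tau> \<circ> r) k)) \<longlonglongrightarrow> z t" for t
  proof -
    have "((\<lambda>n. F (r1 n) t) \<circ> r3) \<longlonglongrightarrow> z t"
      using z r3 by (rule LIMSEQ_subseq_LIMSEQ)
    moreover have "eventually (\<lambda>k. ((\<lambda>n. F (r1 n) t) \<circ> r3) k = x (t + (\<tau> \<circ> r) k)) sequentially"
      using eventually_translate_ge_0[OF lim, of t]
      by eventually_elim (simp add: F_def r_def max_absorb2)
    ultimately show ?thesis
      by (rule Lim_transform_eventually)
  qed
  then have "translates_converge x \<sigma> (\<tau> \<circ> r) z \<rho>"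
    using lim \<rho>(3) by (simp add: translates_converge_def r_def r3_def)
  with r \<rho>(1) show thesis
    by (rule that)
qed

text \<open>Property P only provides forward translates of signals in \<open>S\<close>. A limit signal can
  nevertheless be translated backwards, since the translated limit is again a limit of
  forward translates of \<open>\<sigma>\<close>.\<close>

lemma translates_converge_shift:
  assumes "translates_converge x \<sigma> \<tau> z \<rho>" "\<rho> \<in> S"
  shows "translates_converge x \<sigma> (\<lambda>k. \<tau> k + s) (\<lambda>t. z (t + s)) (\<lambda>t. \<rho> (t + s))"
    and "(\<lambda>t. \<rho> (t + s)) \<in> S"
proof -
  have \<tau>: "filterlim \<tau> at_top sequentially" and z: "\<And>t. (\<lambda>k. x (t + \<tau> k)) \<longlonglongrightarrow> z t"
    and \<rho>: "AE t in lborel. (\<lambda>k. \<sigma> (t + \<tau> k)) \<longlonglongrightarrow> \<rho> t"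
    using assms(1) by (auto simp: translates_converge_def)
  have shift: "AE t in lborel. (\<lambda>k. \<sigma> (t + (\<tau> k + s))) \<longlonglongrightarrow> \<rho> (t + s)"
    using AE_lborel_shift[OF \<rho>, of s] by (simp add: algebra_simps)
  have lim: "filterlim (\<lambda>k. \<tau> k + s) at_top sequentially"
    by (subst add.commute) (rule filterlim_tendsto_add_at_top[OF tendsto_const \<tau>])
  then show "translates_converge x \<sigma> (\<lambda>k. \<tau> k + s) (\<lambda>t. z (t + s)) (\<lambda>t. \<rho> (t + s))"
    using shift z[of "_ + s"] by (simp add: translates_converge_def algebra_simps)
  obtain k0 where k0: "\<And>k. k \<ge> k0 \<Longrightarrow> \<tau> k + s > 0"
    using lim unfolding filterlim_at_top_dense eventually_sequentially by blast
  have "(\<lambda>t. \<sigma> (t + (\<tau> (k + k0) + s))) \<in> S" for k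
    by (intro translate_in_S k0) simp
  then obtain \<rho>' r where \<rho>': "\<rho>' \<in> S" and r: "strict_mono (r :: nat \<Rightarrow> nat)"
    and conv: "AE t in lborel. (\<lambda>l. \<sigma> (t + (\<tau> (r l + k0) + s))) \<longlonglongrightarrow> \<rho>' t"
    by (rule signal_compactness[of "\<lambda>k t. \<sigma> (t + (\<tau> (k + k0) + s))"])
  have r': "strict_mono (\<lambda>l. r l + k0)"
    using r by (simp add: strict_mono_def)
  \<comment> \<open>Both signals are almost-everywhere limits along the same subsequence, so the
    pair lies in the diagonal for almost every time. The diagonal is closed, and right continuity
    extends the equality to all times.\<close>
  from conv shift have "AE t in lborel. (\<rho>' t, \<rho> (t + s)) \<in> {p. \<exists>a. p = (a, a)}"
  proof eventually_elim
    case (elim t)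
    then show ?case
      using LIMSEQ_subseq_LIMSEQ[OF elim(2) r'] LIMSEQ_unique by (fastforce simp: comp_def)
  qed
  moreover have "continuous (at_right t) (\<lambda>t. (\<rho>' t, \<rho> (t + s)))" for t
    using signal_right_continuous \<rho>' \<open>\<rho> \<in> S\<close>
    by (intro continuous_Pair continuous_at_right_shift) auto
  moreover have "closed {p :: 'g \<times> 'g. \<exists>a. p = (a, a)}"
    using closed_diagonal by (simp add: setcompr_eq_image full_SetCompr_eq)
  ultimately have "(\<rho>' t, \<rho> (t + s)) \<in> {p. \<exists>a. p = (a, a)}" for t
    by (intro right_continuous_AE_in_closed[of t "\<lambda>t. (\<rho>' t, \<rho> (t + s))"])
  then have "\<rho>' = (\<lambda>t. \<rho> (t + s))"
    by auto
  then show "(\<lambda>t. \<rho> (t + s)) \<in> S"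
    using \<rho>' by simp
qed

section \<open>Regularity and dynamics of a single limit pair\<close>

context
  fixes \<tau> z \<rho>
  assumes conv: "translates_converge x \<sigma> \<tau> z \<rho>" and \<rho>_in: "\<rho> \<in> S"
begin

lemma \<tau>_at_top: "filterlim \<tau> at_top sequentially"
  and x_conv: "(\<lambda>k. x (t + \<tau> k)) \<longlonglongrightarrow> z t"
  and \<sigma>_conv: "AE t in lborel. (\<lambda>k. \<sigma> (t + \<tau> k)) \<longlonglongrightarrow> \<rho> t"
  using conv by (auto simp: translates_converge_def)

lemma limit_Lipschitz: "dist (z s) (z t) \<le> L * \<bar>s - t\<bar>"
proof (rule tendsto_upperbound)
  show "(\<lambda>k. dist (x (s + \<tau> k)) (x (t + \<tau> k))) \<longlonglongrightarrow> dist (z s) (z t)"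
    by (intro tendsto_dist x_conv)
  show "eventually (\<lambda>k. dist (x (s + \<tau> k)) (x (t + \<tau> k)) \<le> L * \<bar>s - t\<bar>) sequentially"
    using eventually_translate_ge_0[OF \<tau>_at_top, of s] eventually_translate_ge_0[OF \<tau>_at_top, of t]
  proof eventually_elim
    case (elim k)
    then show ?case
      using x_Lipschitz[of "s + \<tau> k" "t + \<tau> k"] by simp
  qed
qed simp

lemma limit_right_continuous: "continuous (at_right t) (\<lambda>t. (z t, \<rho> t))"
proof (intro continuous_Pair signal_right_continuous \<rho>_in)
  have "L-lipschitz_on UNIV z"
    using limit_Lipschitz L_pos by (intro lipschitz_onI) (auto simp: dist_real_def)
  then have "continuous_on UNIV z"
    by (rule lipschitz_on_continuous_on)
  then show "continuous (at_right t) z"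
    by (simp add: continuous_on_eq_continuous_at continuous_at_imp_continuous_at_within)
qed

lemma limit_in_K_D_if_conv:
  assumes "(\<lambda>k. \<sigma> (t + \<tau> k)) \<longlonglongrightarrow> \<rho> t"
  shows "(z t, \<rho> t) \<in> K \<inter> D"
proof (rule Lim_in_closed_set)
  show "closed (K \<inter> D)"
    using compact_K_D by (rule compact_imp_closed)
  show "(\<lambda>k. (x (t + \<tau> k), \<sigma> (t + \<tau> k))) \<longlonglongrightarrow> (z t, \<rho> t)"
    by (intro tendsto_Pair x_conv assms)
  show "eventually (\<lambda>k. (x (t + \<tau> k), \<sigma> (t + \<tau> k)) \<in> K \<inter> D) sequentially"
    using eventually_translate_ge_0[OF \<tau>_at_top, of t] by eventually_elim (simp add: in_K in_D)
qed simp

text \<open>Where the signals converge, closedness of \<open>K \<inter> D\<close> suffices; right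
  continuity of the limit pair fills in the exceptional null set.\<close>

lemma limit_in_K_D: "(z t, \<rho> t) \<in> K \<inter> D"
proof -
  have "AE t in lborel. (z t, \<rho> t) \<in> K \<inter> D"
    using \<sigma>_conv by eventually_elim (rule limit_in_K_D_if_conv)
  then show ?thesis
    by (intro right_continuous_AE_in_closed[of t "\<lambda>t. (z t, \<rho> t)"] limit_right_continuous
        compact_imp_closed compact_K_D)
qed

text \<open>Dominated convergence with the constant bound \<open>L\<close> passes to the limit in
  the integral equation of the translates.\<close>

lemma limit_has_integral:
  assumes "a \<le> b"
  shows "((\<lambda>t. f (z t, \<rho> t)) has_integral (z b - z a)) {a..b}"
proof -
  obtain N where N: "\<And>t. t \<notin> N \<Longrightarrow> (\<lambda>k. \<sigma> (t + \<tau> k)) \<longlonglongrightarrow> \<rho> t" "N \<in> null_sets lborel"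
    using \<sigma>_conv by (rule AE_E3) auto
  have negl: "negligible N"
    using N(2) by (simp add: negligible_iff_null_sets null_sets_completionI)
  \<comment> \<open>Skipping \<open>k0\<close> indices places every translated interval inside the
    nonnegative times, where \<open>x\<close> solves the equation and stays in
    \<open>K\<close>.\<close>
  obtain k0 where "\<And>k. k \<ge> k0 \<Longrightarrow> 0 \<le> a + \<tau> k"
    using eventually_translate_ge_0[OF \<tau>_at_top, of a] unfolding eventually_sequentially by blast
  then have k0: "0 \<le> a + \<tau> (k + k0)" for k
    by simp
  define g where "g = (\<lambda>k t. f (x (t + \<tau> (k + k0)), \<sigma> (t + \<tau> (k + k0))))"
  \<comment> \<open>Setting both integrands to 0 on \<open>N\<close> makes the convergence hold at
    every point of the interval; a change on a negligible set does not affect the integrals.\<close>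
  define G where "G = (\<lambda>k t. if t \<in> N then 0 else g k t)"
  define H where "H = (\<lambda>t. if t \<in> N then 0 else f (z t, \<rho> t))"
  have "(g k has_integral (x (b + \<tau> (k + k0)) - x (a + \<tau> (k + k0)))) {a..b}" for k
  proof -
    have "((\<lambda>t. f (x t, \<sigma> t)) has_integral (x (b + \<tau> (k + k0)) - x (a + \<tau> (k + k0))))
        (cbox (a + \<tau> (k + k0)) (b + \<tau> (k + k0)))"
      unfolding box_real using I_ge_0 k0[of k] assms
      by (intro trajectory_has_integral[OF traj]) auto
    from has_integral_affinity'[OF this, of 1 "\<tau> (k + k0)"] show ?thesis
      by (simp add: g_def)
  qed
  then have G: "(G k has_integral (x (b + \<tau> (k + k0)) - x (a + \<tau> (k + k0)))) {a..b}" for k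
    by (rule has_integral_spike[OF negl, rotated]) (simp add: G_def)
  have bound: "norm (G k t) \<le> L" if "t \<in> {a..b}" for k t
  proof -
    have "0 \<le> t + \<tau> (k + k0)"
      using k0[of k] that by auto
    then show ?thesis
      using L_pos by (auto simp: G_def g_def intro!: field_le_L in_K in_D)
  qed
  have lim: "(\<lambda>k. G k t) \<longlonglongrightarrow> H t" if "t \<in> {a..b}" for t
  proof (cases "t \<in> N")
    case False
    have "(\<lambda>k. f (x (t + \<tau> k), \<sigma> (t + \<tau> k))) \<longlonglongrightarrow> f (z t, \<rho> t)"
    proof (rule continuous_on_tendsto_compose[OF cont_f])
      show "(\<lambda>k. (x (t + \<tau> k), \<sigma> (t + \<tau> k))) \<longlonglongrightarrow> (z t, \<rho> t)"
        by (intro tendsto_Pair x_conv N(1)[OF False])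
      show "(z t, \<rho> t) \<in> D"
        using limit_in_K_D by blast
      show "eventually (\<lambda>k. (x (t + \<tau> k), \<sigma> (t + \<tau> k)) \<in> D) sequentially"
        using eventually_translate_ge_0[OF \<tau>_at_top, of t] by eventually_elim (rule in_D)
    qed
    then show ?thesis
      using False LIMSEQ_ignore_initial_segment[of "\<lambda>k. f (x (t + \<tau> k), \<sigma> (t + \<tau> k))" _ k0]
      by (simp add: G_def H_def g_def)
  qed (simp add: G_def H_def)
  have dc: "H integrable_on {a..b}" "(\<lambda>k. integral {a..b} (G k)) \<longlonglongrightarrow> integral {a..b} H"
    using dominated_convergence[of G "{a..b}" "\<lambda>_. L" H] G bound lim by auto
  have "(\<lambda>k. x (b + \<tau> (k + k0)) - x (a + \<tau> (k + k0))) \<longlonglongrightarrow> z b - z a"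
    using LIMSEQ_ignore_initial_segment[OF tendsto_diff[OF x_conv[of b] x_conv[of a]], of k0] by simp
  moreover have "integral {a..b} (G k) = x (b + \<tau> (k + k0)) - x (a + \<tau> (k + k0))" for k
    using G by (rule integral_unique)
  ultimately have "integral {a..b} H = z b - z a"
    using dc(2) LIMSEQ_unique by auto
  then have "(H has_integral (z b - z a)) {a..b}"
    using dc(1) by (metis integrable_integral)
  then show ?thesis
    by (rule has_integral_spike[OF negl, rotated]) (simp add: H_def)
qed

lemma limit_complete_trajectory: "(z, \<rho>) \<in> complete_trajectories \<Gamma> D f S"
proof -
  have "trajectory \<Gamma> D f UNIV z \<rho>"
    using limit_in_K_D cont_f limit_Lipschitz limit_has_integral
    by (intro complete_trajectoryI[where L = L] signal_switching \<rho>_in) auto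
  then show ?thesis
    using \<rho>_in by (simp add: complete_trajectories_def)
qed

end

section \<open>Vanishing of the output along limit pairs\<close>

text \<open>The signals need not converge at time 0 itself, so values of \<open>y\<close> at
  \<open>\<tau> k\<close> give no information. One sample time of convergence per cell is used
  instead: on a jump-free cell it determines the signal throughout.\<close>

lemma limit_output_zero_at_0:
  assumes conv: "translates_converge x \<sigma> \<tau> z \<rho>" and \<rho>_in: "\<rho> \<in> S"
    and cont_h: "continuous_on K h" and wm: "weakly_meagre (\<lambda>t. h (x t, \<sigma> t))"
  shows "h (z 0, \<rho> 0) = 0"
proof (rule ccontr)
  assume nz: "h (z 0, \<rho> 0) \<noteq> 0"
  define c where "c = \<bar>h (z 0, \<rho> 0)\<bar> / 2"
  have "c > 0"
    using nz by (simp add: c_def)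
  have "(z 0, \<rho> 0) \<in> K"
    using limit_in_K_D[OF conv \<rho>_in] by blast
  with cont_h \<open>c > 0\<close> obtain \<eta> where "\<eta> > 0"
    and \<eta>: "\<And>p. \<lbrakk>p \<in> K; dist p (z 0, \<rho> 0) < \<eta>\<rbrakk> \<Longrightarrow> dist (h p) (h (z 0, \<rho> 0)) < c"
    unfolding continuous_on_iff by metis
  have large: "c \<le> \<bar>h p\<bar>" if "p \<in> K" "dist p (z 0, \<rho> 0) < \<eta>" for p
    using \<eta>[OF that] unfolding c_def dist_real_def by linarith
  have "eventually (\<lambda>t. dist (\<rho> t) (\<rho> 0) < \<eta> / 4) (at_right 0)"
    using signal_right_continuous[OF \<rho>_in, of 0] \<open>\<eta> > 0\<close>
    by (intro tendstoD) (auto simp: continuous_within)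
  then obtain d0 where "d0 > 0" and d0: "\<And>t. \<lbrakk>0 < t; t < d0\<rbrakk> \<Longrightarrow> dist (\<rho> t) (\<rho> 0) < \<eta> / 4"
    unfolding eventually_at_right_field by auto
  \<comment> \<open>The tolerance \<open>\<eta>\<close> is spent in quarters: the drift of
    \<open>x\<close> over time \<open>d\<close>, the distance of \<open>x (\<tau> k)\<close> to
    \<open>z 0\<close>, the signal convergence at the sample time, and the variation of
    \<open>\<rho>\<close> on the right of 0.\<close>
  define d where "d = min d0 (\<eta> / (4 * L))"
  have "d > 0"
    using \<open>d0 > 0\<close> \<open>\<eta> > 0\<close> L_pos by (simp add: d_def)
  have "L * d \<le> L * (\<eta> / (4 * L))"
    using L_pos by (intro mult_left_mono) (auto simp: d_def)
  then have Ld: "L * d \<le> \<eta> / 4"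
    using L_pos by simp
  obtain \<tau>\<^sub>D N\<^sub>0 where "\<tau>\<^sub>D > 0" and dwell: "S \<subseteq> average_dwell_signals \<Gamma> \<tau>\<^sub>D N\<^sub>0"
    using prop_P by (auto simp: property_P_def)
  \<comment> \<open>\<open>m\<close> depends on \<open>d\<close> and the dwell constants but not on
    \<open>k\<close>. Hence the cell length \<open>w\<close> is fixed before \<open>k\<close> is
    chosen.\<close>
  obtain m :: nat where m: "real N\<^sub>0 + (d - 0) / \<tau>\<^sub>D < real m"
    using reals_Archimedean2 by blast
  have "0 < d / \<tau>\<^sub>D"
    using \<open>d > 0\<close> \<open>\<tau>\<^sub>D > 0\<close> by simp
  with m have "m > 0"
    by (cases "m = 0") auto
  define w where "w = d / m"
  have w: "w > 0" "real m * w = d"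
    using \<open>d > 0\<close> \<open>m > 0\<close> by (auto simp: w_def)
  define J where "J = (\<lambda>i. {real i * w<..<real (Suc i) * w})"
  have J_sub: "t \<in> J i \<Longrightarrow> 0 < t \<and> t < d" if "i < m" for i t
  proof -
    assume "t \<in> J i"
    moreover have "real (Suc i) * w \<le> real m * w"
      using that w(1) by (intro mult_right_mono) auto
    moreover have "0 \<le> real i * w"
      using w(1) by simp
    ultimately show ?thesis
      using w(2) unfolding J_def greaterThanLessThan_iff by linarith
  qed
  have "\<exists>s. s \<in> J i \<and> (\<lambda>k. \<sigma> (s + \<tau> k)) \<longlonglongrightarrow> \<rho> s" for i
  proof -
    have "real i * w < real (Suc i) * w"
      using w(1) by simp
    then obtain u where "real i * w < u" "u < real (Suc i) * w" "(\<lambda>k. \<sigma> (u + \<tau> k)) \<longlonglongrightarrow> \<rho> u"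
      by (rule AE_interval_ex[OF \<sigma>_conv[OF conv \<rho>_in]])
    then show ?thesis
      unfolding J_def greaterThanLessThan_iff by blast
  qed
  then obtain s where s: "\<And>i. s i \<in> J i" "\<And>i. (\<lambda>k. \<sigma> (s i + \<tau> k)) \<longlonglongrightarrow> \<rho> (s i)"
    by metis
  have "\<exists>a\<ge>T. \<forall>t\<in>{a<..<a + w}. c \<le> \<bar>h (x t, \<sigma> t)\<bar>" for T
  proof -
    \<comment> \<open>There are finitely many sample times, so one large \<open>k\<close> serves all
      cells, whichever of them turns out to be jump-free.\<close>
    have "eventually (\<lambda>k. \<forall>i\<in>{..<m}. dist (\<sigma> (s i + \<tau> k)) (\<rho> (s i)) < \<eta> / 4) sequentially"
      using \<open>\<eta> > 0\<close> s(2) by (intro eventually_ball_finite ballI tendstoD) auto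
    moreover have "eventually (\<lambda>k. dist (x (0 + \<tau> k)) (z 0) < \<eta> / 4) sequentially"
      by (rule tendstoD[OF x_conv[OF conv \<rho>_in]]) (use \<open>\<eta> > 0\<close> in simp)
    moreover have "eventually (\<lambda>k. max 0 T < \<tau> k) sequentially"
      using \<tau>_at_top[OF conv \<rho>_in] unfolding filterlim_at_top_dense by blast
    ultimately have "eventually (\<lambda>k. (\<forall>i\<in>{..<m}. dist (\<sigma> (s i + \<tau> k)) (\<rho> (s i)) < \<eta> / 4) \<and>
        dist (x (0 + \<tau> k)) (z 0) < \<eta> / 4 \<and> max 0 T < \<tau> k) sequentially"
      by (intro eventually_conj)
    then obtain k where k: "\<And>i. i < m \<Longrightarrow> dist (\<sigma> (s i + \<tau> k)) (\<rho> (s i)) < \<eta> / 4"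
      "dist (x (\<tau> k)) (z 0) < \<eta> / 4" "0 < \<tau> k" "T < \<tau> k"
      using eventually_happens'[OF sequentially_bot] by fastforce
    define \<sigma>' where "\<sigma>' = (\<lambda>t. \<sigma> (t + \<tau> k))"
    have \<sigma>'_in: "\<sigma>' \<in> S"
      unfolding \<sigma>'_def using k(3) by (rule translate_in_S)
    with dwell have "\<sigma>' \<in> average_dwell_signals \<Gamma> \<tau>\<^sub>D N\<^sub>0"
      by blast
    from average_dwell_jump_free_cell[OF this \<open>\<tau>\<^sub>D > 0\<close> \<open>d > 0\<close> m]
    obtain i where i: "i < m" and free: "jump_times \<sigma>' \<inter> J i = {}"
      unfolding J_def w_def by auto
    have cell: "c \<le> \<bar>h (x (u + \<tau> k), \<sigma> (u + \<tau> k))\<bar>" if u: "u \<in> J i" for u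
    proof (rule large)
      have "0 < u" "u < d"
        using J_sub[OF i u] by auto
      then show "(x (u + \<tau> k), \<sigma> (u + \<tau> k)) \<in> K"
        using k(3) by (intro in_K) auto
      have "dist (x (u + \<tau> k)) (x (\<tau> k)) \<le> L * u"
        using x_Lipschitz[of "u + \<tau> k" "\<tau> k"] \<open>0 < u\<close> k(3) by simp
      also have "\<dots> \<le> L * d"
        using \<open>u < d\<close> L_pos by simp
      finally have "dist (x (u + \<tau> k)) (z 0) < \<eta> / 2"
        using Ld k(2) dist_triangle[of "x (u + \<tau> k)" "z 0" "x (\<tau> k)"] by linarith
      moreover have "\<sigma> (u + \<tau> k) = \<sigma> (s i + \<tau> k)"
        using switching_signal_eq_if_no_jump[OF signal_switching[OF \<sigma>'_in] free[unfolded J_def]]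
          u s(1)[of i] unfolding J_def \<sigma>'_def by blast
      moreover have "dist (\<rho> (s i)) (\<rho> 0) < \<eta> / 4"
        using J_sub[OF i s(1)] by (intro d0) (auto simp: d_def)
      moreover have "dist (\<sigma> (s i + \<tau> k)) (\<rho> 0) \<le> dist (\<sigma> (s i + \<tau> k)) (\<rho> (s i)) + dist (\<rho> (s i)) (\<rho> 0)"
        by (rule dist_triangle)
      ultimately have "dist (x (u + \<tau> k)) (z 0) + dist (\<sigma> (u + \<tau> k)) (\<rho> 0) < \<eta>"
        using k(1)[OF i] by simp
      then show "dist (x (u + \<tau> k), \<sigma> (u + \<tau> k)) (z 0, \<rho> 0) < \<eta>"
        using dist_Pair_le_sum order_le_less_trans by blast
    qed
    have "c \<le> \<bar>h (x t, \<sigma> t)\<bar>" if "t \<in> {real i * w + \<tau> k<..<real i * w + \<tau> k + w}" for t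
      using cell[of "t - \<tau> k"] that by (simp add: J_def algebra_simps)
    moreover have "T \<le> real i * w + \<tau> k"
      using k(4) w(1) by (simp add: add_increasing)
    ultimately show ?thesis
      by blast
  qed
  then have "\<not> weakly_meagre (\<lambda>t. h (x t, \<sigma> t))"
    by (rule not_weakly_meagreI[OF \<open>c > 0\<close> w(1)])
  then show False
    using wm by contradiction
qed

text \<open>The pair shifted by \<open>t\<close> is again a limit pair, which reduces the claim to
  time 0.\<close>

lemma limit_output_zero:
  assumes "translates_converge x \<sigma> \<tau> z \<rho>" "\<rho> \<in> S"
    and "continuous_on K h" "weakly_meagre (\<lambda>t. h (x t, \<sigma> t))"
  shows "h (z t, \<rho> t) = 0"
  using limit_output_zero_at_0[OF translates_converge_shift[OF assms(1,2), of t] assms(3,4)] by simp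

section \<open>The limit set and convergence to it\<close>

text \<open>An omega-limit set in the product of states and modes. It collects values of limit pairs
  instead of cluster points of \<open>(x t, \<sigma> t)\<close>, so that each point comes with a
  complete trajectory through it.\<close>

definition limit_set where
  "limit_set = {(z 0, \<rho> 0) | z \<rho>. \<rho> \<in> S \<and> (\<exists>\<tau>. translates_converge x \<sigma> \<tau> z \<rho>)}"

lemma limit_setI: "\<lbrakk>translates_converge x \<sigma> \<tau> z \<rho>; \<rho> \<in> S\<rbrakk> \<Longrightarrow> (z 0, \<rho> 0) \<in> limit_set"
  unfolding limit_set_def by blast

text \<open>A limit pair is itself the required trajectory, since its value at \<open>t\<close> is
  the value at 0 of the shifted pair. Translates by the natural numbers show that such pairs
  exist.\<close>

lemma limit_set_weakly_invariant: "weakly_invariant (complete_trajectories \<Gamma> D f S) limit_set"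
  unfolding weakly_invariant_def
proof (intro conjI ballI)
  obtain r z \<rho> where "\<rho> \<in> S" "translates_converge x \<sigma> (real \<circ> r) z \<rho>"
    using translates_converge_subseq[OF filterlim_real_sequentially] by metis
  then show "limit_set \<noteq> {}"
    using limit_setI by blast
next
  fix p assume "p \<in> limit_set"
  then obtain z \<rho> \<tau> where *: "p = (z 0, \<rho> 0)" "\<rho> \<in> S" "translates_converge x \<sigma> \<tau> z \<rho>"
    unfolding limit_set_def by blast
  have "(z t, \<rho> t) \<in> limit_set" for t
    using limit_setI[OF translates_converge_shift[OF *(3,2), of t]] by simp
  then show "case p of (\<xi>, \<gamma>) \<Rightarrow> \<exists>(x, \<sigma>)\<in>complete_trajectories \<Gamma> D f S.
      x 0 = \<xi> \<and> \<sigma> 0 = \<gamma> \<and> (\<forall>t. (x t, \<sigma> t) \<in> limit_set)"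
    using limit_complete_trajectory[OF *(3,2)] *(1) by auto
qed

text \<open>If the distance stayed above \<open>e\<close> along some times tending to infinity, a
  subsequence of the translates would converge, with states at 0 tending to a point of the
  projection; continuity of the distance gives a contradiction.\<close>

lemma tends_to_limit_set:
  assumes "limit_set \<subseteq> M"
  shows "tends_to_set x (fst ` M)"
  unfolding tends_to_set_def
proof (rule ccontr)
  assume "\<not> ((\<lambda>t. infdist (x t) (fst ` M)) \<longlongrightarrow> 0) at_top"
  then obtain e where "e > 0" "\<not> eventually (\<lambda>t. dist (infdist (x t) (fst ` M)) 0 < e) at_top"
    unfolding tendsto_iff by blast
  then have "\<forall>n::nat. \<exists>t\<ge>real n. e \<le> infdist (x t) (fst ` M)"
    unfolding eventually_at_top_linorder by (auto simp: infdist_nonneg not_less)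
  then obtain \<tau> where \<tau>: "\<And>n::nat. \<tau> n \<ge> real n" "\<And>n. e \<le> infdist (x (\<tau> n)) (fst ` M)"
    by metis
  have "filterlim \<tau> at_top sequentially"
    using \<tau>(1) by (intro filterlim_at_top_mono[OF filterlim_real_sequentially]) auto
  then obtain r z \<rho> where r: "\<rho> \<in> S" "translates_converge x \<sigma> (\<tau> \<circ> r) z \<rho>"
    using translates_converge_subseq by metis
  then have "z 0 \<in> fst ` M"
    using limit_setI[OF r(2,1)] assms by force
  then have "infdist (z 0) (fst ` M) = 0"
    by simp
  moreover have "(\<lambda>k. infdist (x (0 + (\<tau> \<circ> r) k)) (fst ` M)) \<longlonglongrightarrow> infdist (z 0) (fst ` M)"
    by (intro tendsto_infdist x_conv[OF r(2,1)])
  then have "e \<le> infdist (z 0) (fst ` M)"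
    by (rule LIMSEQ_le_const) (use \<tau>(2) in auto)
  ultimately show False
    using \<open>e > 0\<close> by simp
qed

end

text \<open>To speak of the maximal set presupposes that exactly one exists, so this is asserted
  first. Both claims rest on \<open>limit_set\<close>, a weakly invariant subset of the zero set: it
  forces existence and is contained in the maximal set, whose projection is therefore
  nonempty.\<close>

theorem theorem3p4:
  fixes \<Gamma> :: "'g::metric_space set"
    and Df :: "((real^'n) \<times> 'g) set"
    and f :: "(real^'n) \<times> 'g \<Rightarrow> real^'n"
    and S :: "(real \<Rightarrow> 'g) set"
    and I :: "real set"
    and x :: "real \<Rightarrow> real^'n"
    and \<sigma> :: "real \<Rightarrow> 'g"
    and Dh K :: "((real^'n) \<times> 'g) set"
    and h :: "(real^'n) \<times> 'g \<Rightarrow> real"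
  assumes "compact \<Gamma>"
    and "Df \<subseteq> UNIV \<times> \<Gamma>" and "closed Df" and "continuous_on Df f"
    and "property_P \<Gamma> S"
    and "\<sigma> \<in> S" and "trajectory \<Gamma> Df f I x \<sigma>" and "{0..} \<subseteq> I"
    and "Dh \<subseteq> UNIV \<times> \<Gamma>" and "continuous_on Dh h"
    and "compact K" and "K \<subseteq> Dh" and "\<forall>t\<ge>0. (x t, \<sigma> t) \<in> K"
    and "weakly_meagre (\<lambda>t. h (x t, \<sigma> t))"
  shows "(\<exists>!M. maximal_weakly_invariant_in (complete_trajectories \<Gamma> Df f S)
                 ({p \<in> Dh. h p = 0} \<inter> Df) M) \<and>
         (\<forall>M. maximal_weakly_invariant_in (complete_trajectories \<Gamma> Df f S)
                 ({p \<in> Dh. h p = 0} \<inter> Df) M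
              \<longrightarrow> tends_to_set x (fst ` M))"
proof -
  interpret precompact_trajectory \<Gamma> Df f S I x \<sigma> K
    using assms by unfold_locales auto
  have "continuous_on K h"
    using assms by (metis continuous_on_subset)
  then have "limit_set \<subseteq> {p \<in> Dh. h p = 0} \<inter> Df"
    using limit_in_K_D limit_output_zero assms(14) \<open>K \<subseteq> Dh\<close> unfolding limit_set_def by blast
  note * = maximal_weakly_invariant_in_unique_ex[OF limit_set_weakly_invariant this]
  show ?thesis
    by (intro conjI allI impI *(1) tends_to_limit_set *(2))
qed

end
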